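(* Let $\theta\in\left(0,\frac{\sqrt5+1}{2}\right)$, and let $\{(s_k,y_k,x_k)\}$ be a sequence generated by the proximal ADMM with stepsize $\theta$, penalty parameter $\beta>0$, self-adjoint positive semidefinite operators $H,G$ and initial point $(s_0,y_0,x_0)$. For $k\ge1$ let $$\tilde x_k = x_{k-1}-\beta(Cy_{k-1}+Ds_k-c).$$ Then, for every $k\ge 1$, $$H(s_{k-1}-s_k)\in \partial g(s_k)-D^*\tilde x_k,\qquad (G+\beta C^*C)(y_{k-1}-y_k)\in\partial f(y_k)-C^*\tilde x_k,\qquad \frac{1}{\beta\theta}(x_{k-1}-x_k)=Cy_k+Ds_k-c,$$ and there exists $i\le k$ (with $i\geq 1$) such that $$\left(\|s_{i-1}-s_i\|_{\mathcal S,H}^2+\|y_{i-1}-y_i\|_{\mathcal Y,(G+\beta C^*C)}^2+\frac1{\beta\theta}\|x_{i-1}-x_i\|_{\mathcal X}^2\right)^{1/2}\le \frac{2\sqrt{d_0}}{\sqrt k}\sqrt{\frac{1+\sigma_\theta+2\tau_\theta}{1-\sigma_\theta}} .$$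
   Context: Setting. $\mathcal S,\mathcal Y,\mathcal X$ are finite-dimensional real inner product spaces; $f:\mathcal Y\to(-\infty,\infty]$ and $g:\mathcal S\to(-\infty,\infty]$ are proper closed convex functions; $C:\mathcal Y\to\mathcal X$, $D:\mathcal S\to\mathcal X$ are linear operators with adjoints $C^*,D^*$; $c\in\mathcal X$. The problem is $\inf\{f(y)+g(s): Cy+Ds=c\}$. For a self-adjoint positive semidefinite operator $A$ on a space $\mathcal V$, $\|v\|_{\mathcal V,A}=\langle Av,v\rangle_{\mathcal V}^{1/2}$. $\partial$ denotes the convex subdifferential, $f^*,g^*$ the convex conjugates, $\mathrm{ri}$ the relative interior. Let $T(s,y,x)=(\partial g(s)-D^*x)\times(\partial f(y)-C^*x)\times\{Cy+Ds-c\}$ on $\mathcal S\times\mathcal Y\times\mathcal X$, and let $T^{-1}(0)$ be the set of $(s,y,x)$ with $0\in T(s,y,x)$. Standing assumptions: (A1) $T^{-1}(0)\neq\emptyset$ (equivalently the problem has an optimal solution with an associated Lagrange multiplier); (A2) there exists $x\in\mathcal X$ with $(C^*x,D^*x)\in \mathrm{ri}(\mathrm{dom} f^* )\times\mathrm{ri}(\mathrm{dom} g^* )$. Proximal ADMM. Given $(s_0,y_0,x_0)\in\mathcal S\times\mathcal Y\times\mathcal X$, $\beta>0$, $\theta>0$, and self-adjoint positive semidefinite linear operators $H:\mathcal S\to\mathcal S$, $G:\mathcal Y\to\mathcal Y$, for $k=1,2,\dots$: $s_k$ is an optimal solution of $$\min_{s\in\mathcal S}\left\{g(s)-\langle D^*x_{k-1},s\rangle_{\mathcal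 S}+\tfrac\beta2\|Cy_{k-1}+Ds-c\|_{\mathcal X}^2+\tfrac12\|s-s_{k-1}\|_{\mathcal S,H}^2\right\},$$ $y_k$ is an optimal solution of $$\min_{y\in\mathcal Y}\left\{f(y)-\langle C^*x_{k-1},y\rangle_{\mathcal Y}+\tfrac\beta2\|Cy+Ds_k-c\|_{\mathcal X}^2+\tfrac12\|y-y_{k-1}\|_{\mathcal Y,G}^2\right\},$$ and $x_k=x_{k-1}-\theta\beta[Cy_k+Ds_k-c]$. Constants: $$d_0=\inf_{(s,y,x)\in T^{-1}(0)}\left\{\tfrac12\|s_0-s\|_{\mathcal S,H}^2+\tfrac12\|y_0-y\|_{\mathcal Y,(G+\beta C^*C)}^2+\tfrac1{2\beta\theta}\|x_0-x\|_{\mathcal X}^2\right\},$$ $$\sigma_\theta=\frac{3\theta^2-7\theta+5+\sqrt{(3\theta^2-7\theta+5)^2-4(2-\theta)(3-\theta)(\theta-1)^2}}{2(3-\theta)},\qquad \tau_\theta=4\max\left\{\frac1{\sqrt\theta},\frac{\sqrt\theta}{2-\theta}\right\}.$$ (One has $\sigma_\theta\in(0,1)$ for $\theta\in(0,(\sqrt5+1)/2)$.) *)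

theory Defs
  imports "HOL-Analysis.Analysis"
begin

text \<open>Extended-real-valued convex functions. \<open>epigraph\<close> of \<open>HOL-Analysis\<close> covers only real-valued
  functions; as there, the epigraph is a subset of the space times the finite reals.\<close>

definition epi :: "('a \<Rightarrow> ereal) \<Rightarrow> ('a \<times> real) set" where
  "epi f = {(x, r). f x \<le> ereal r}"

definition eff_dom :: "('a \<Rightarrow> ereal) \<Rightarrow> 'a set" where
  "eff_dom f = {x. f x < \<infinity>}"

definition proper_closed_convex :: "('a::real_inner \<Rightarrow> ereal) \<Rightarrow> bool" where
  "proper_closed_convex f \<longleftrightarrow>
     (\<forall>x. f x \<noteq> -\<infinity>) \<and> (\<exists>x. f x \<noteq> \<infinity>) \<and> closed (epi f) \<and> convex (epi f)"

text \<open>For proper \<open>f\<close> the subdifferential is empty outside \<open>eff_dom f\<close>, because the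
  inequality then fails at any \<open>z\<close> with \<open>f z\<close> finite.\<close>

definition subdifferential :: "('a::real_inner \<Rightarrow> ereal) \<Rightarrow> 'a \<Rightarrow> 'a set" where
  "subdifferential f x = {v. \<forall>z. f x + ereal (v \<bullet> (z - x)) \<le> f z}"

definition conjugate :: "('a::real_inner \<Rightarrow> ereal) \<Rightarrow> 'a \<Rightarrow> ereal" where
  "conjugate f v = (SUP x. ereal (v \<bullet> x) - f x)"

definition self_adjoint_psd :: "('a::real_inner \<Rightarrow> 'a) \<Rightarrow> bool" where
  "self_adjoint_psd A \<longleftrightarrow>
     linear A \<and> (\<forall>u v. A u \<bullet> v = u \<bullet> A v) \<and> (\<forall>v. 0 \<le> A v \<bullet> v)"

definition seminorm_op :: "('a::real_inner \<Rightarrow> 'a) \<Rightarrow> 'a \<Rightarrow> real" where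
  "seminorm_op A v = sqrt (A v \<bullet> v)"

definition kkt_map ::
  "('y::real_inner \<Rightarrow> ereal) \<Rightarrow> ('s::real_inner \<Rightarrow> ereal) \<Rightarrow>
   ('y \<Rightarrow> 'x::real_inner) \<Rightarrow> ('s \<Rightarrow> 'x) \<Rightarrow> 'x \<Rightarrow> 's \<times> 'y \<times> 'x \<Rightarrow> ('s \<times> 'y \<times> 'x) set" where
  "kkt_map f g C D c = (\<lambda>(s, y, x).
     ((\<lambda>u. u - adjoint D x) ` subdifferential g s) \<times>
     ((\<lambda>u. u - adjoint C x) ` subdifferential f y) \<times> {C y + D s - c})"

definition kkt_points ::
  "('y::real_inner \<Rightarrow> ereal) \<Rightarrow> ('s::real_inner \<Rightarrow> ereal) \<Rightarrow>
   ('y \<Rightarrow> 'x::real_inner) \<Rightarrow> ('s \<Rightarrow> 'x) \<Rightarrow> 'x \<Rightarrow> ('s \<times> 'y \<times> 'x) set" where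
  "kkt_points f g C D c = {z. 0 \<in> kkt_map f g C D c z}"

definition y_op ::
  "('y::real_inner \<Rightarrow> 'x::real_inner) \<Rightarrow> real \<Rightarrow> ('y \<Rightarrow> 'y) \<Rightarrow> 'y \<Rightarrow> 'y" where
  "y_op C \<beta> G = (\<lambda>v. G v + \<beta> *\<^sub>R adjoint C (C v))"

definition prox_admm ::
  "('y::real_inner \<Rightarrow> ereal) \<Rightarrow> ('s::real_inner \<Rightarrow> ereal) \<Rightarrow>
   ('y \<Rightarrow> 'x::real_inner) \<Rightarrow> ('s \<Rightarrow> 'x) \<Rightarrow> 'x \<Rightarrow> real \<Rightarrow> real \<Rightarrow> ('s \<Rightarrow> 's) \<Rightarrow> ('y \<Rightarrow> 'y) \<Rightarrow>
   (nat \<Rightarrow> 's) \<Rightarrow> (nat \<Rightarrow> 'y) \<Rightarrow> (nat \<Rightarrow> 'x) \<Rightarrow> bool" where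
  "prox_admm f g C D c \<beta> \<theta> H G s y x \<longleftrightarrow> (\<forall>k\<ge>1.
     is_arg_min
       (\<lambda>z. g z + ereal (- (adjoint D (x (k-1)) \<bullet> z)
              + \<beta> / 2 * (norm (C (y (k-1)) + D z - c))\<^sup>2
              + 1 / 2 * (seminorm_op H (z - s (k-1)))\<^sup>2))
       (\<lambda>z. True) (s k) \<and>
     is_arg_min
       (\<lambda>z. f z + ereal (- (adjoint C (x (k-1)) \<bullet> z)
              + \<beta> / 2 * (norm (C z + D (s k) - c))\<^sup>2
              + 1 / 2 * (seminorm_op G (z - y (k-1)))\<^sup>2))
       (\<lambda>z. True) (y k) \<and>
     x k = x (k-1) - (\<theta> * \<beta>) *\<^sub>R (C (y k) + D (s k) - c))"

definition dist_sq_kkt ::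
  "('y::real_inner \<Rightarrow> ereal) \<Rightarrow> ('s::real_inner \<Rightarrow> ereal) \<Rightarrow>
   ('y \<Rightarrow> 'x::real_inner) \<Rightarrow> ('s \<Rightarrow> 'x) \<Rightarrow> 'x \<Rightarrow> real \<Rightarrow> real \<Rightarrow> ('s \<Rightarrow> 's) \<Rightarrow> ('y \<Rightarrow> 'y) \<Rightarrow>
   's \<Rightarrow> 'y \<Rightarrow> 'x \<Rightarrow> real" where
  "dist_sq_kkt f g C D c \<beta> \<theta> H G s0 y0 x0 =
     (INF (s, y, x) \<in> kkt_points f g C D c.
        1 / 2 * (seminorm_op H (s0 - s))\<^sup>2
        + 1 / 2 * (seminorm_op (y_op C \<beta> G) (y0 - y))\<^sup>2
        + 1 / (2 * \<beta> * \<theta>) * (norm (x0 - x))\<^sup>2)"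

definition sigma_const :: "real \<Rightarrow> real" where
  "sigma_const \<theta> =
     (3 * \<theta>\<^sup>2 - 7 * \<theta> + 5
        + sqrt ((3 * \<theta>\<^sup>2 - 7 * \<theta> + 5)\<^sup>2 - 4 * (2 - \<theta>) * (3 - \<theta>) * (\<theta> - 1)\<^sup>2))
     / (2 * (3 - \<theta>))"

definition tau_const :: "real \<Rightarrow> real" where
  "tau_const \<theta> = 4 * max (1 / sqrt \<theta>) (sqrt \<theta> / (2 - \<theta>))"

end

(* Summing the monotonicity inequalities of the two subdifferentials at an iterate and at a KKT
   point gives a descent inequality for the squared distance E to the KKT point, up to the cross
   term 2/theta <C dy_k, dx_k>.  Monotonicity of the subdifferential of f at two consecutive
   iterates bounds this term below by 2 (1/theta - 1) <C dy_k, dx_(k-1)> plus a telescoping part, so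
   that E + (2/theta - 2 + rho) |dx_k|^2 / (beta theta) + |dy_k|_G^2 is a Lyapunov function with
   decrease (1 - rho) |step|^2 whenever rho (2/theta - 2 + rho) >= (1 - theta)^2 / theta.  The constant sigma_theta violates this
   condition for theta near the golden ratio, but rho = (2 + sigma_theta) / 3 satisfies it, and the
   factor 3 lost in 1 - rho is absorbed by the size of tau_theta. *)

theory Submission
  imports Defs
begin

section \<open>The constants\<close>

text \<open>Completing the square. With b = 3 \<theta>^2 - 7 \<theta> + 5,
  \<open>sigma_const \<theta>\<close> is the larger root of q(t) = (3 - \<theta>) t^2 - b t + (2 -
  \<theta>) (\<theta> - 1)^2, so every t with q(t) at most 0 bounds it from below.\<close>

lemma le_larger_root:
  fixes a b d t :: real
  assumes "a > 0" "a * t\<^sup>2 - b * t + d \<le> 0"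
  shows "t \<le> (b + sqrt (b\<^sup>2 - 4 * a * d)) / (2 * a)"
proof -
  have "(2 * a * t - b)\<^sup>2 = 4 * a * (a * t\<^sup>2 - b * t + d) + (b\<^sup>2 - 4 * a * d)"
    by (simp add: power2_eq_square algebra_simps)
  also have "\<dots> \<le> b\<^sup>2 - 4 * a * d" using assms by (simp add: mult_nonneg_nonpos)
  finally have "2 * a * t - b \<le> sqrt (b\<^sup>2 - 4 * a * d)" by (rule real_le_rsqrt)
  then show ?thesis using assms by (simp add: field_simps)
qed

lemma below_golden_ratio:
  assumes "\<theta> \<in> {0<..<(sqrt 5 + 1) / 2}"
  shows "0 < \<theta>" "0 < 1 + \<theta> - \<theta>\<^sup>2" "\<theta> < 81 / 50"
proof -
  show 0: "0 < \<theta>" using assms by simp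
  have "2 * \<theta> - 1 < sqrt 5" using assms by simp
  \<comment> \<open>A rational just above sqrt 5; (56 / 25 + 1) / 2 = 81 / 50.\<close>
  moreover have "sqrt 5 < 56 / 25" by (rule real_less_lsqrt) (auto simp: power2_eq_square)
  ultimately show "\<theta> < 81 / 50" by simp
  have "1 < sqrt 5" by simp
  then have "\<bar>2 * \<theta> - 1\<bar> < sqrt 5" using \<open>2 * \<theta> - 1 < sqrt 5\<close> 0 by linarith
  then have "(2 * \<theta> - 1)\<^sup>2 < 5"
    by (metis abs_ge_zero power2_abs real_sqrt_abs real_sqrt_less_iff)
  then show "0 < 1 + \<theta> - \<theta>\<^sup>2" by (simp add: power2_eq_square algebra_simps)
qed

text \<open>The upper bound 1 comes from q(1) = \<theta> (1 + \<theta> - \<theta>^2), which is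
  positive below the golden ratio, where q is the quadratic with larger root
  \<open>sigma_const \<theta>\<close>. The third bound is what \<open>relaxed_sigma_bound\<close>
  asks for.\<close>

lemma sigma_const_bounds:
  assumes "\<theta> \<in> {0<..<(sqrt 5 + 1) / 2}"
  shows "0 < sigma_const \<theta>" "sigma_const \<theta> < 1"
    and "1 - sigma_const \<theta> \<le> 3 / 2 * (1 + \<theta> - \<theta>\<^sup>2)"
proof -
  note th = below_golden_ratio[OF assms]
  define b where "b = 3 * \<theta>\<^sup>2 - 7 * \<theta> + 5"
  define \<Delta> where "\<Delta> = b\<^sup>2 - 4 * (2 - \<theta>) * (3 - \<theta>) * (\<theta> - 1)\<^sup>2"
  have sig: "sigma_const \<theta> = (b + sqrt \<Delta>) / (2 * (3 - \<theta>))"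
    by (simp add: sigma_const_def b_def \<Delta>_def)
  have a: "0 < 3 - \<theta>" using th by simp
  have b: "0 < b"
  proof -
    have "b = 3 * (\<theta> - 7 / 6)\<^sup>2 + 11 / 12" by (simp add: b_def power2_eq_square algebra_simps)
    then show ?thesis by (smt (verit) zero_le_power2 divide_pos_pos)
  qed
  have disc: "0 \<le> \<Delta>"
  proof -
    have "\<Delta> = (1 - \<theta>)\<^sup>2 + \<theta>\<^sup>2 * (5 * (\<theta> - 7 / 5)\<^sup>2 + 1 / 5)"
      by (simp add: \<Delta>_def b_def power2_eq_square algebra_simps)
    then show ?thesis by simp
  qed
  have "0 < (b + sqrt \<Delta>) / (2 * (3 - \<theta>))"
    using a b disc by (intro divide_pos_pos) (auto simp: add_pos_nonneg)
  then show "0 < sigma_const \<theta>" by (simp add: sig)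
  have vertex: "b / (2 * (3 - \<theta>)) \<le> sigma_const \<theta>"
    unfolding sig using a disc by (intro divide_right_mono) auto
  show "sigma_const \<theta> < 1"
  proof -
    \<comment> \<open>This places 1 to the right of the vertex of q; the comparison with
      \<open>\<Delta>\<close> below is q(1) > 0 multiplied by 4 (3 - \<theta>).\<close>
    have "0 < 2 * (3 - \<theta>) - b"
    proof (cases "\<theta> \<le> 1")
      case True
      then have "\<theta>\<^sup>2 \<le> \<theta>" using th unfolding power2_eq_square by (intro mult_left_le) auto
      moreover have "2 * (3 - \<theta>) - b = 1 + 2 * \<theta> + 3 * (\<theta> - \<theta>\<^sup>2)"
        by (simp add: b_def algebra_simps)
      ultimately show ?thesis using th by (simp add: add_pos_nonneg)
    qed (use th in \<open>simp add: b_def\<close>)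
    moreover have "\<Delta> < (2 * (3 - \<theta>) - b)\<^sup>2"
    proof -
      have "(2 * (3 - \<theta>) - b)\<^sup>2 - \<Delta> = 4 * (3 - \<theta>) * (\<theta> * (1 + \<theta> - \<theta>\<^sup>2))"
        by (simp add: \<Delta>_def b_def power2_eq_square algebra_simps)
      then show ?thesis using th a
        by (smt (verit) mult_pos_pos)
    qed
    ultimately have "sqrt \<Delta> < 2 * (3 - \<theta>) - b" by (intro real_less_lsqrt) auto
    then show ?thesis using a by (simp add: sig)
  qed
  show "1 - sigma_const \<theta> \<le> 3 / 2 * (1 + \<theta> - \<theta>\<^sup>2)"
  \<comment> \<open>For small \<theta> it suffices that the larger root lies to the right of the
    vertex. This estimate fails shortly before 1.4, while testing the sign of q at 1 - 3/2 (1 +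
    \<theta> - \<theta>^2) works from about 1.3 on; 11 / 8 lies between.\<close>
  proof (cases "\<theta> \<le> 11 / 8")
    case True
    have "1 - b / (2 * (3 - \<theta>)) \<le> 3 / 2 * (1 + \<theta> - \<theta>\<^sup>2)"
    proof -
      have "0 \<le> 8 + \<theta> - 9 * \<theta>\<^sup>2 + 3 * \<theta> ^ 3"
      proof -
        \<comment> \<open>Division of the cubic by 11 / 8 - \<theta>; the remainder 81 / 512 is its
          value at 11 / 8.\<close>
        have e: "8 + \<theta> - 9 * \<theta>\<^sup>2 + 3 * \<theta> ^ 3
          = (11 / 8 - \<theta>) * (365 / 64 + 39 / 8 * \<theta> - 3 * \<theta>\<^sup>2) + 81 / 512"
          by (simp add: power2_eq_square power3_eq_cube field_simps)
        have "0 \<le> \<theta> * (11 / 8 - \<theta>)" using th True by simp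
        then have "0 \<le> 365 / 64 + 39 / 8 * \<theta> - 3 * \<theta>\<^sup>2"
          using th by (simp add: power2_eq_square algebra_simps)
        then have "0 \<le> (11 / 8 - \<theta>) * (365 / 64 + 39 / 8 * \<theta> - 3 * \<theta>\<^sup>2)" using True by simp
        then show ?thesis unfolding e using th True by simp
      qed
      moreover have "3 * (3 - \<theta>) * (1 + \<theta> - \<theta>\<^sup>2) - (2 * (3 - \<theta>) - b) = 8 + \<theta> - 9 * \<theta>\<^sup>2 + 3 * \<theta> ^ 3"
        by (simp add: b_def power2_eq_square power3_eq_cube algebra_simps)
      moreover have "3 / 2 * (1 + \<theta> - \<theta>\<^sup>2) * (2 * (3 - \<theta>)) = 3 * (3 - \<theta>) * (1 + \<theta> - \<theta>\<^sup>2)"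
        by (simp add: field_simps)
      ultimately have "2 * (3 - \<theta>) - b \<le> 3 / 2 * (1 + \<theta> - \<theta>\<^sup>2) * (2 * (3 - \<theta>))"
        by linarith
      then have "(2 * (3 - \<theta>) - b) / (2 * (3 - \<theta>)) \<le> 3 / 2 * (1 + \<theta> - \<theta>\<^sup>2)"
        using a by (subst pos_divide_le_eq) auto
      then show ?thesis using a by (simp add: diff_divide_distrib)
    qed
    then show ?thesis using vertex by linarith
  next
    case False
    define m where "m = 1 + \<theta> - \<theta>\<^sup>2"
    \<comment> \<open>Taylor expansion of q at 1 with increment - 3/2 m: q(1) = \<theta> m and q'(1)
      = 1 + 5 \<theta> - 3 \<theta>^2, so m factors out and only a cubic in \<theta> has to be
      signed.\<close>
    have "m * (\<theta> - 3 / 2 * (1 + 5 * \<theta> - 3 * \<theta>\<^sup>2) + 9 / 4 * (3 - \<theta>) * m) \<le> 0"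
    proof (rule mult_nonneg_nonpos)
      have e: "\<theta> - 3 / 2 * (1 + 5 * \<theta> - 3 * \<theta>\<^sup>2) + 9 / 4 * (3 - \<theta>) * m
          = (9 * \<theta> ^ 3 - 18 * \<theta>\<^sup>2 - 8 * \<theta> + 21) / 4"
        by (simp add: m_def power2_eq_square power3_eq_cube field_simps)
      \<comment> \<open>The chord of \<theta>^2 over [11 / 8, 81 / 50], used twice, reduces the
        cubic to a linear expression.\<close>
      have "0 \<le> (\<theta> - 11 / 8) * (81 / 50 - \<theta>)" using th False by simp
      then have sq: "\<theta>\<^sup>2 \<le> 599 / 200 * \<theta> - 891 / 400"
        by (simp add: power2_eq_square field_simps)
      then have "\<theta> * \<theta>\<^sup>2 \<le> \<theta> * (599 / 200 * \<theta> - 891 / 400)"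
        using th by (intro mult_left_mono) auto
      then have "\<theta> ^ 3 \<le> 599 / 200 * \<theta>\<^sup>2 - 891 / 400 * \<theta>"
        by (simp add: power2_eq_square power3_eq_cube algebra_simps)
      then have "9 * \<theta> ^ 3 - 18 * \<theta>\<^sup>2 - 8 * \<theta> + 21 \<le> 0"
        using sq th False by (simp add: field_simps)
      then show "\<theta> - 3 / 2 * (1 + 5 * \<theta> - 3 * \<theta>\<^sup>2) + 9 / 4 * (3 - \<theta>) * m \<le> 0"
        unfolding e by simp
    qed (use th in \<open>simp add: m_def\<close>)
    also have "m * (\<theta> - 3 / 2 * (1 + 5 * \<theta> - 3 * \<theta>\<^sup>2) + 9 / 4 * (3 - \<theta>) * m)
        = (3 - \<theta>) * (1 - 3 / 2 * m)\<^sup>2 - b * (1 - 3 / 2 * m) + (2 - \<theta>) * (\<theta> - 1)\<^sup>2"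
      by (simp add: m_def b_def power2_eq_square field_simps)
    finally have "1 - 3 / 2 * m \<le> sigma_const \<theta>"
      using le_larger_root[OF a, of "1 - 3 / 2 * m" b "(2 - \<theta>) * (\<theta> - 1)\<^sup>2"]
      unfolding sig by (simp only: \<Delta>_def mult_ac)
    then show ?thesis unfolding m_def[symmetric] by linarith
  qed
qed

lemma two_abs_le_add:
  fixes a b w :: real
  assumes "0 \<le> a" "0 \<le> b" "w\<^sup>2 \<le> a * b"
  shows "2 * \<bar>w\<bar> \<le> a + b"
proof (rule power2_le_imp_le)
  have "4 * (a * b) \<le> (a + b)\<^sup>2"
    using zero_le_power2[of "a - b"] by (simp add: power2_eq_square algebra_simps)
  then show "(2 * \<bar>w\<bar>)\<^sup>2 \<le> (a + b)\<^sup>2" using assms by (simp add: power_mult_distrib)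
qed (use assms in simp)

text \<open>Put e = 1 - \<rho> = (1 - \<sigma>) / 3. After multiplication by \<theta> the claim
  reads 0 \<le> (1 + \<theta> - \<theta>^2) - 2 e + \<theta> e^2, and the hypothesis makes the first
  two terms nonnegative together.\<close>

lemma relaxed_sigma_bound:
  fixes \<theta> \<sigma> :: real
  assumes "\<theta> > 0" "\<sigma> < 1" "1 - \<sigma> \<le> 3 / 2 * (1 + \<theta> - \<theta>\<^sup>2)"
  defines "\<rho> \<equiv> (2 + \<sigma>) / 3"
  shows "(1 - \<theta>)\<^sup>2 / \<theta> \<le> \<rho> * (2 / \<theta> - 2 + \<rho>)"
proof -
  have "0 \<le> (1 + \<theta> - \<theta>\<^sup>2) - 2 / 3 * (1 - \<sigma>) + \<theta> * ((1 - \<sigma>) / 3)\<^sup>2"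
    using assms by (intro add_nonneg_nonneg) auto
  also have "\<dots> = \<theta> * \<rho>\<^sup>2 + 2 * (1 - \<theta>) * \<rho> - (1 - \<theta>)\<^sup>2"
    by (simp add: \<rho>_def power2_eq_square field_simps)
  finally have "(1 - \<theta>)\<^sup>2 \<le> \<rho> * (2 / \<theta> - 2 + \<rho>) * \<theta>"
    using \<open>\<theta> > 0\<close> by (simp add: algebra_simps power2_eq_square)
  then show ?thesis using \<open>\<theta> > 0\<close> by (simp add: pos_divide_le_eq)
qed

section \<open>Summation of the scalar recursions\<close>

text \<open>The real arithmetic of the convergence proof, detached from the spaces: \<open>E\<close>
  is the squared distance to a KKT point, \<open>P\<close>, \<open>R\<close>, \<open>U\<close>,
  \<open>V\<close> are the parts of the squared step, and \<open>W\<close>, \<open>W'\<close> are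
  the inner products of the y-step with the current and the previous multiplier step. As
  \<open>cross\<close> starts at 2, the first step is estimated through \<open>U1\<close> and
  \<open>N1\<close>.\<close>

lemma admm_summation:
  fixes E P R U V W W' :: "nat \<Rightarrow> real"
  assumes theta: "\<theta> \<in> {0<..<(sqrt 5 + 1) / 2}"
    and nonneg: "\<And>k. 0 \<le> E k" "\<And>k. 0 \<le> P k" "\<And>k. 0 \<le> R k" "\<And>k. 0 \<le> U k" "\<And>k. 0 \<le> V k"
    and descent: "\<And>k. 1 \<le> k \<Longrightarrow> E k + P k + R k + V k + (2 / \<theta> - 1) * U k + 2 * W k \<le> E (k - 1)"
    and cross: "\<And>k. 2 \<le> k \<Longrightarrow> 2 * ((1 / \<theta> - 1) * W' k) + (R k - R (k - 1)) \<le> 2 * W k"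
    and W: "\<And>k. 1 \<le> k \<Longrightarrow> (W k)\<^sup>2 \<le> U k * V k / \<theta>"
    and W': "\<And>k. 2 \<le> k \<Longrightarrow> (W' k)\<^sup>2 \<le> \<theta> * (U (k - 1) * V k)"
    and U1: "U 1 \<le> 2 * E 1 + 2 * E 0"
    and N1: "P 1 + R 1 + V 1 + U 1 \<le> 2 * E 1 + 2 * E 0"
    and "1 \<le> k"
  shows "(1 - sigma_const \<theta>) * (\<Sum>i=1..k. P i + R i + V i + U i)
    \<le> 2 * (1 + sigma_const \<theta> + 2 * tau_const \<theta>) * E 0"
proof -
  note th = below_golden_ratio[OF theta]
  note sig = sigma_const_bounds[OF theta]
  define \<rho> where "\<rho> = (2 + sigma_const \<theta>) / 3"
  \<comment> \<open>Chosen so that the coefficient 2 / \<theta> - 1 of \<open>U k\<close> in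
    \<open>descent\<close> splits into \<open>\<eta>\<close>, kept in the Lyapunov function
    \<open>\<Phi>\<close>, and 1 - \<open>\<rho>\<close>, spent on the step.\<close>
  define \<eta> where "\<eta> = 2 / \<theta> - 2 + \<rho>"
  have \<rho>: "0 < \<rho>" "\<rho> < 1" using sig by (auto simp: \<rho>_def)
  have \<rho>\<eta>: "(1 - \<theta>)\<^sup>2 / \<theta> \<le> \<rho> * \<eta>"
    using relaxed_sigma_bound[OF th(1) sig(2,3)] by (simp add: \<rho>_def \<eta>_def)
  moreover have "0 \<le> (1 - \<theta>)\<^sup>2 / \<theta>" using th by simp
  ultimately have "0 \<le> \<rho> * \<eta>" by linarith
  then have \<eta>: "0 \<le> \<eta>" using \<rho> by (simp add: zero_le_mult_iff)
  define N where "N i = P i + R i + V i + U i" for i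
  define \<Phi> where "\<Phi> k = E k + \<eta> * U k + R k" for k
  have step: "\<Phi> k + (1 - \<rho>) * N k \<le> \<Phi> (k - 1)" if k: "2 \<le> k" for k
  proof -
    \<comment> \<open>Young's inequality with weights \<open>\<rho>\<close> on \<open>V k\<close>
      and \<open>\<eta>\<close> on \<open>U (k - 1)\<close>: the first leaves 1 -
      \<open>\<rho>\<close> of \<open>V k\<close>, the second is paid by
      \<open>\<Phi> (k - 1)\<close>.\<close>
    have "((1 / \<theta> - 1) * W' k)\<^sup>2 \<le> (1 / \<theta> - 1)\<^sup>2 * (\<theta> * (U (k - 1) * V k))"
      using W'[OF k] by (simp add: power_mult_distrib mult_left_mono)
    also have "\<dots> = (1 - \<theta>)\<^sup>2 / \<theta> * (U (k - 1) * V k)"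
      using th by (simp add: power2_eq_square field_simps)
    also have "\<dots> \<le> \<rho> * \<eta> * (U (k - 1) * V k)"
      using \<rho>\<eta> nonneg by (intro mult_right_mono) auto
    finally have "2 * \<bar>(1 / \<theta> - 1) * W' k\<bar> \<le> \<rho> * V k + \<eta> * U (k - 1)"
      using \<rho> \<eta> nonneg by (intro two_abs_le_add) (auto simp: mult_ac)
    then have "- (\<rho> * V k + \<eta> * U (k - 1)) \<le> 2 * ((1 / \<theta> - 1) * W' k)" by linarith
    also have "\<dots> \<le> 2 * W k - (R k - R (k - 1))" using cross[OF k] by simp
    finally have "E k + P k + R k + V k + (2 / \<theta> - 1) * U k
        - (\<rho> * V k + \<eta> * U (k - 1)) + (R k - R (k - 1)) \<le> E (k - 1)"
      using descent[of k] k by linarith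
    moreover have "0 \<le> \<rho> * P k" "0 \<le> \<rho> * R k" using \<rho> nonneg by auto
    ultimately show ?thesis by (simp add: \<Phi>_def N_def \<eta>_def algebra_simps)
  qed
  have "\<Phi> k + (1 - \<rho>) * (\<Sum>i=1..k. N i) \<le> \<Phi> 1 + (1 - \<rho>) * N 1"
    using \<open>1 \<le> k\<close>
  proof (induction k rule: dec_induct)
    case (step n)
    then show ?case using \<open>\<And>k. 2 \<le> k \<Longrightarrow> \<Phi> k + (1 - \<rho>) * N k \<le> \<Phi> (k - 1)\<close>[of "Suc n"]
      by (simp add: distrib_left)
  qed simp
  moreover have "0 \<le> \<Phi> k" using nonneg \<eta> by (simp add: \<Phi>_def)
  ultimately have sum: "(1 - \<rho>) * (\<Sum>i=1..k. N i) \<le> \<Phi> 1 + (1 - \<rho>) * N 1" by linarith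
  \<comment> \<open>In the first step the cross term is estimated directly. Equal weights 1 / sqrt
    \<theta> on \<open>U 1\<close> and \<open>V 1\<close> produce the square root that appears in
    \<open>tau_const\<close>.\<close>
  define r where "r = sqrt \<theta>"
  have r: "0 < r" "r\<^sup>2 = \<theta>" using th by (auto simp: r_def)
  have "(W 1)\<^sup>2 \<le> (U 1 / r) * (V 1 / r)"
    using W[of 1] r(1) by (simp add: power2_eq_square flip: r(2))
  then have "2 * \<bar>W 1\<bar> \<le> U 1 / r + V 1 / r" using nonneg r by (intro two_abs_le_add) auto
  moreover have "0 \<le> \<rho> * P 1" "0 \<le> \<rho> * R 1" "0 \<le> \<rho> * V 1" using \<rho> nonneg by auto
  ultimately have first: "\<Phi> 1 + (1 - \<rho>) * N 1 \<le> E 0 + R 1 + (U 1 + V 1) / r"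
    using descent[of 1] by (simp add: \<Phi>_def N_def \<eta>_def algebra_simps add_divide_distrib)
  \<comment> \<open>Different weights, to bound \<open>E 1\<close>: now \<open>V 1\<close> cancels
    completely.\<close>
  have "(W 1)\<^sup>2 \<le> (U 1 / \<theta>) * V 1" using W[of 1] by simp
  then have "2 * \<bar>W 1\<bar> \<le> U 1 / \<theta> + V 1" using nonneg th by (intro two_abs_le_add) auto
  moreover have "E 1 + V 1 + (2 / \<theta> - 1) * U 1 + 2 * W 1 \<le> E 0"
    using descent[of 1] nonneg(2)[of 1] nonneg(3)[of 1] by simp
  ultimately have E1: "E 1 \<le> E 0 + (1 - 1 / \<theta>) * U 1" by (simp add: algebra_simps)
  \<comment> \<open>The factor 2 / 3 makes up for 1 - \<open>\<rho>\<close> being only a third of 1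
    - \<open>sigma_const \<theta>\<close>.\<close>
  have "E 0 + R 1 + (U 1 + V 1) / r \<le> 2 / 3 * (1 + 2 * tau_const \<theta>) * E 0"
  proof (cases "\<theta> \<le> 1")
    case True
    then have r1: "r \<le> 1" by (simp add: r_def)
    \<comment> \<open>For \<theta> at most 1 the first step does not increase the distance, so
      \<open>N 1\<close> is at most 4 \<open>E 0\<close>.\<close>
    have "(1 - 1 / \<theta>) * U 1 \<le> 0" using True th nonneg by (intro mult_nonpos_nonneg) auto
    then have "N 1 \<le> 4 * E 0" using E1 N1 by (simp add: N_def)
    moreover have "R 1 + (U 1 + V 1) / r \<le> N 1 / r"
    proof -
      have "r * R 1 \<le> R 1" using r1 nonneg(3) by (simp add: mult_left_le_one_le r less_imp_le)
      then have "(r * R 1 + (U 1 + V 1)) / r \<le> N 1 / r"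
        using nonneg(2)[of 1] r by (intro divide_right_mono) (simp_all add: N_def)
      then show ?thesis using r by (simp add: add_divide_distrib)
    qed
    moreover have "N 1 / r \<le> 4 * E 0 / r" using calculation(1) r by (simp add: divide_right_mono)
    ultimately have "E 0 + R 1 + (U 1 + V 1) / r \<le> (1 + 4 / r) * E 0" by (simp add: algebra_simps)
    also have "\<dots> \<le> 2 / 3 * (1 + 2 * tau_const \<theta>) * E 0"
    proof (rule mult_right_mono)
      have "4 / r \<le> tau_const \<theta>" by (simp add: tau_const_def r_def)
      moreover have "1 \<le> 1 / r" using r r1 by simp
      ultimately show "1 + 4 / r \<le> 2 / 3 * (1 + 2 * tau_const \<theta>)" by simp
    qed (rule nonneg)
    finally show ?thesis .
  next
    case False
    then have r1: "1 < r" by (simp add: r_def)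
    have pos: "0 < 2 - \<theta>" using th by simp
    \<comment> \<open>For \<theta> > 1 the distance may grow. Bounding \<open>U 1\<close> by the
      distances themselves gives an inequality solvable for \<open>E 1\<close> because \<theta> < 2;
      this is the origin of the denominator 2 - \<theta>.\<close>
    have "(1 - 1 / \<theta>) * U 1 \<le> (1 - 1 / \<theta>) * (2 * E 1 + 2 * E 0)"
      using U1 False by (intro mult_left_mono) auto
    then have "\<theta> * E 1 \<le> \<theta> * (E 0 + (1 - 1 / \<theta>) * (2 * E 1 + 2 * E 0))"
      using E1 th by (intro mult_left_mono) auto
    also have "\<dots> = \<theta> * E 0 + (\<theta> - 1) * (2 * E 1 + 2 * E 0)"
      using th by (simp add: field_simps)
    finally have "(2 - \<theta>) * E 1 \<le> (3 * \<theta> - 2) * E 0" by (simp add: algebra_simps)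
    then have "E 1 \<le> (3 * \<theta> - 2) / (2 - \<theta>) * E 0" using pos by (simp add: field_simps)
    then have K: "N 1 \<le> 2 * ((3 * \<theta> - 2) / (2 - \<theta>) * E 0) + 2 * E 0"
      using N1 unfolding N_def by linarith
    have "(U 1 + V 1) / r \<le> U 1 + V 1"
      using r1 nonneg(4)[of 1] nonneg(5)[of 1] mult_right_mono[of 1 r "U 1 + V 1"]
      by (simp add: pos_divide_le_eq mult.commute)
    then have "E 0 + R 1 + (U 1 + V 1) / r \<le> E 0 + N 1" using nonneg(2)[of 1] by (simp add: N_def)
    also have "\<dots> \<le> (3 + 2 * ((3 * \<theta> - 2) / (2 - \<theta>))) * E 0"
      using K unfolding distrib_right by linarith
    also have "\<dots> \<le> 2 / 3 * (1 + 2 * tau_const \<theta>) * E 0"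
    proof (rule mult_right_mono)
      \<comment> \<open>The claim reduces to 2 + 11 r^2 \<le> 16 r; the chord of r^2 over
        [1, 13 / 10] makes it linear.\<close>
      have "r < 13 / 10" unfolding r_def using th
        by (intro real_less_lsqrt) (auto simp: power2_eq_square)
      then have "(r - 1) * (13 / 10 - r) \<ge> 0" using r1 by simp
      then have "r\<^sup>2 \<le> 23 / 10 * r - 13 / 10" by (simp add: power2_eq_square field_simps)
      then have "2 + 11 * \<theta> \<le> 16 * r" using \<open>r < 13 / 10\<close> r(2) by linarith
      then have "(2 + 11 * \<theta>) / (2 - \<theta>) \<le> 16 * r / (2 - \<theta>)"
        using pos by (intro divide_right_mono) auto
      moreover have "(2 + 11 * \<theta>) / (2 - \<theta>) = 3 * (3 + 2 * ((3 * \<theta> - 2) / (2 - \<theta>))) - 2"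
        using pos by (simp add: field_simps)
      moreover have "4 * (r / (2 - \<theta>)) \<le> tau_const \<theta>"
        unfolding tau_const_def r_def by (intro mult_left_mono) auto
      ultimately show "3 + 2 * ((3 * \<theta> - 2) / (2 - \<theta>)) \<le> 2 / 3 * (1 + 2 * tau_const \<theta>)"
        by simp
    qed (rule nonneg)
    finally show ?thesis .
  qed
  then have "3 * ((1 - \<rho>) * (\<Sum>i=1..k. N i)) \<le> 2 * (1 + 2 * tau_const \<theta>) * E 0"
    using sum first by linarith
  moreover have "3 * ((1 - \<rho>) * (\<Sum>i=1..k. N i)) = (1 - sigma_const \<theta>) * (\<Sum>i=1..k. N i)"
    by (simp add: \<rho>_def field_simps)
  moreover have "0 \<le> 2 * sigma_const \<theta> * E 0" using sig nonneg by simp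
  ultimately show ?thesis by (simp add: N_def algebra_simps)
qed

section \<open>Adjoints, subgradients and positive semidefinite operators\<close>

text \<open>\<open>adjoint\<close> is defined by choice, so its identity follows once some map
  satisfies it. The witness is the expansion along an orthogonal spanning set.\<close>

lemma adjoint_works_finite_dim:
  fixes F :: "'a::real_inner \<Rightarrow> 'b::real_inner"
  assumes fin: "\<exists>B::'a set. finite B \<and> span B = UNIV" and F: "linear F"
  shows "F u \<bullet> w = u \<bullet> adjoint F w"
proof -
  obtain B0 :: "'a set" where "finite B0" "span B0 = UNIV" using fin by blast
  then obtain B :: "'a set" where B: "finite B" "span B = UNIV" "pairwise orthogonal B"
    using basis_orthogonal[of B0] by metis
  define F' where "F' w = (\<Sum>b\<in>B. ((F b \<bullet> w) / (b \<bullet> b)) *\<^sub>R b)" for w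
  have basis: "F b \<bullet> w = b \<bullet> F' w" if "b \<in> B" for b w
  proof -
    have "b \<bullet> F' w = (\<Sum>a\<in>B. (F a \<bullet> w) / (a \<bullet> a) * (b \<bullet> a))"
      by (simp add: F'_def inner_sum_right)
    also have "\<dots> = (\<Sum>a\<in>B. if a = b then F b \<bullet> w else 0)"
    proof (rule sum.cong)
      fix a assume "a \<in> B"
      show "(F a \<bullet> w) / (a \<bullet> a) * (b \<bullet> a) = (if a = b then F b \<bullet> w else 0)"
      proof (cases "a = b")
        case True
        \<comment> \<open>The spanning set may contain 0; then division by zero gives 0, which
          agrees with \<open>F 0 = 0\<close>.\<close>
        then show ?thesis using linear_0[OF F] by (cases "b = 0") auto
      next
        case False
        then have "b \<bullet> a = 0"
          using B(3) that \<open>a \<in> B\<close> by (auto simp: pairwise_def orthogonal_def)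
        then show ?thesis using False by simp
      qed
    qed simp
    also have "\<dots> = F b \<bullet> w" using that B(1) by simp
    finally show ?thesis by simp
  qed
  have "F u \<bullet> w = u \<bullet> F' w" for u w
  proof (rule linear_eq_on[where B = B and f = "\<lambda>u. F u \<bullet> w" and g = "\<lambda>u. u \<bullet> F' w"])
    show "linear (\<lambda>u. F u \<bullet> w)"
      by (rule linearI) (simp_all add: linear_add[OF F] linear_scale[OF F] inner_add_left)
    show "linear (\<lambda>u. u \<bullet> F' w)" by (rule linearI) (simp_all add: inner_add_left)
  qed (use B basis in auto)
  then have "\<forall>u w. F u \<bullet> w = u \<bullet> adjoint F w"
    unfolding adjoint_def by - (rule someI[where x = F'], blast)
  then show ?thesis by blast
qed

lemma linear_adjointI:
  assumes "\<And>u w. F u \<bullet> w = u \<bullet> adjoint F w"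
  shows "linear (adjoint F)"
  by (rule linearI; subst vector_eq_ldot[symmetric])
     (simp_all add: inner_add_right flip: assms)

section \<open>Convex subdifferentials\<close>

lemma subdifferential_finite:
  assumes "proper_closed_convex f" "v \<in> subdifferential f p"
  shows "\<bar>f p\<bar> \<noteq> \<infinity>"
proof -
  obtain z where "f z \<noteq> \<infinity>" using assms(1) by (auto simp: proper_closed_convex_def)
  moreover have "f p + ereal (v \<bullet> (z - p)) \<le> f z"
    using assms(2) by (auto simp: subdifferential_def)
  ultimately have "f p \<noteq> \<infinity>" by auto
  moreover have "f p \<noteq> -\<infinity>" using assms(1) by (auto simp: proper_closed_convex_def)
  ultimately show ?thesis by auto
qed

lemma subdifferential_monotone:
  assumes f: "proper_closed_convex f"
    and v: "v \<in> subdifferential f p" and w: "w \<in> subdifferential f q"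
  shows "0 \<le> (v - w) \<bullet> (p - q)"
proof -
  obtain a b where "f p = ereal a" "f q = ereal b"
    using subdifferential_finite[OF f v] subdifferential_finite[OF f w] by auto
  moreover have "f p + ereal (v \<bullet> (q - p)) \<le> f q" "f q + ereal (w \<bullet> (p - q)) \<le> f p"
    using v w by (auto simp: subdifferential_def)
  ultimately have "a + v \<bullet> (q - p) \<le> b" "b + w \<bullet> (p - q) \<le> a" by auto
  then show ?thesis by (simp add: inner_diff_left inner_diff_right)
qed

text \<open>Fermat's rule for a convex function plus a smooth one. The assumption on
  \<open>q\<close> says that it is quadratic along each line through \<open>m\<close> with gradient
  \<open>- v\<close>.\<close>

lemma arg_min_subgradient:
  fixes f :: "'a::real_inner \<Rightarrow> ereal"
  assumes f: "proper_closed_convex f"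
    and min: "is_arg_min (\<lambda>z. f z + ereal (q z)) (\<lambda>z. True) m"
    and q: "\<And>d t. q (m + t *\<^sub>R d) = q m - t * (v \<bullet> d) + t\<^sup>2 * r d"
  shows "v \<in> subdifferential f m"
  unfolding subdifferential_def
proof (intro CollectI allI)
  fix z
  have le: "f m + ereal (q m) \<le> f z + ereal (q z)" for z
    using min by (auto simp: is_arg_min_def not_less)
  have ninf: "f z \<noteq> -\<infinity>" for z using f by (auto simp: proper_closed_convex_def)
  obtain z0 where "f z0 \<noteq> \<infinity>" using f by (auto simp: proper_closed_convex_def)
  then have "f m \<noteq> \<infinity>" using le[of z0] by auto
  then obtain a where a: "f m = ereal a" using ninf[of m] by (cases "f m") auto
  show "f m + ereal (v \<bullet> (z - m)) \<le> f z"
  proof (cases "f z")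
    case (real b)
    define d where "d = z - m"
    \<comment> \<open>Minimality compares \<open>m\<close> with a point of the segment to
      \<open>z\<close>, where convexity bounds \<open>f\<close>; dividing by t leaves an error t *
      \<open>r d\<close>, which vanishes as t tends to 0.\<close>
    have step: "v \<bullet> d \<le> b - a + t * r d" if t: "0 < t" "t \<le> 1" for t
    proof -
      have "convex (epi f)" "(m, a) \<in> epi f" "(z, b) \<in> epi f"
        using f a real by (auto simp: proper_closed_convex_def epi_def)
      then have "(1 - t) *\<^sub>R (m, a) + t *\<^sub>R (z, b) \<in> epi f"
        using t by (intro convexD) auto
      moreover have "(1 - t) *\<^sub>R m + t *\<^sub>R z = m + t *\<^sub>R d"
        by (simp add: d_def algebra_simps)
      ultimately have conv: "f (m + t *\<^sub>R d) \<le> ereal ((1 - t) * a + t * b)"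
        by (simp add: epi_def)
      have "ereal (a + q m) \<le> f (m + t *\<^sub>R d) + ereal (q (m + t *\<^sub>R d))"
        using le[of "m + t *\<^sub>R d"] a by simp
      also have "\<dots> \<le> ereal ((1 - t) * a + t * b) + ereal (q (m + t *\<^sub>R d))"
        using conv by (intro add_right_mono)
      finally have "a + q m \<le> (1 - t) * a + t * b + q (m + t *\<^sub>R d)" by simp
      then have "t * (v \<bullet> d) \<le> t * (b - a + t * r d)"
        by (simp add: q algebra_simps power2_eq_square)
      then show ?thesis using t by simp
    qed
    have "((\<lambda>t. b - a + t * r d) \<longlongrightarrow> b - a + 0 * r d) (at_right 0)"
      by (intro tendsto_intros)
    moreover have "\<forall>\<^sub>F t in at_right 0. v \<bullet> d \<le> b - a + t * r d"
      by (rule eventually_mono[OF eventually_at_right_real[of 0 1]]) (auto intro: step)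
    ultimately have "v \<bullet> d \<le> b - a + 0 * r d"
      by (rule tendsto_lowerbound) simp
    then show ?thesis using a real by (simp add: d_def)
  qed (use a ninf in auto)
qed

section \<open>Quadratic forms of positive semidefinite operators\<close>

lemma psd_form_nonneg:
  assumes "self_adjoint_psd A"
  shows "0 \<le> A v \<bullet> v"
  using assms unfolding self_adjoint_psd_def by blast

lemma seminorm_op_sq:
  assumes "self_adjoint_psd A"
  shows "(seminorm_op A v)\<^sup>2 = A v \<bullet> v"
  using psd_form_nonneg[OF assms] by (simp add: seminorm_op_def)

lemma psd_add_form:
  assumes "self_adjoint_psd A"
  shows "A (u + v) \<bullet> (u + v) = A u \<bullet> u + 2 * (A u \<bullet> v) + A v \<bullet> v"
proof -
  have "linear A" "A v \<bullet> u = A u \<bullet> v"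
    using assms by (auto simp: self_adjoint_psd_def inner_commute)
  then show ?thesis by (simp add: linear_add inner_add_left inner_add_right)
qed

lemma psd_minus_form:
  assumes "self_adjoint_psd A"
  shows "A (- v) = - A v"
  using assms by (simp add: self_adjoint_psd_def linear_neg)

lemma psd_sym:
  assumes "self_adjoint_psd A"
  shows "A u \<bullet> v = A v \<bullet> u"
  using assms by (auto simp: self_adjoint_psd_def inner_commute)

lemma psd_diff_form:
  assumes "self_adjoint_psd A"
  shows "A (u - v) \<bullet> (u - v) = A u \<bullet> u - 2 * (A u \<bullet> v) + A v \<bullet> v"
  using psd_add_form[OF assms, of u "- v"] by (simp add: psd_minus_form[OF assms])

lemma psd_three_point:
  assumes "self_adjoint_psd A"
  shows "2 * (A (p - q) \<bullet> (p - r))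
    = A (p - r) \<bullet> (p - r) - A (q - r) \<bullet> (q - r) + A (p - q) \<bullet> (p - q)"
  using psd_diff_form[OF assms, of "p - r" "p - q"] psd_sym[OF assms, of "p - r" "p - q"] by simp

lemma psd_young:
  assumes "self_adjoint_psd A"
  shows "2 * (A u \<bullet> v) \<le> A u \<bullet> u + A v \<bullet> v"
  using psd_form_nonneg[OF assms, of "u - v"] unfolding psd_diff_form[OF assms] by simp

text \<open>The parallelogram law with the square of the sum dropped.\<close>

lemma psd_diff_le:
  assumes "self_adjoint_psd A"
  shows "A (p - q) \<bullet> (p - q) \<le> 2 * (A (p - r) \<bullet> (p - r)) + 2 * (A (q - r) \<bullet> (q - r))"
  using psd_diff_form[OF assms, of "p - r" "q - r"]
    psd_form_nonneg[OF assms, of "(p - r) + (q - r)"] psd_add_form[OF assms, of "p - r" "q - r"]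
  by simp

text \<open>Makes the form identities available for the plain norm of the multiplier space.\<close>

lemma self_adjoint_psd_id: "self_adjoint_psd (\<lambda>v. v)"
  using linear_ident by (simp add: self_adjoint_psd_def)

lemma self_adjoint_psd_y_op:
  assumes C: "linear C" and adj: "\<And>u w. C u \<bullet> w = u \<bullet> adjoint C w"
    and "\<beta> > 0" and G: "self_adjoint_psd G"
  shows "self_adjoint_psd (y_op C \<beta> G)"
    and "y_op C \<beta> G u \<bullet> u = G u \<bullet> u + \<beta> * (norm (C u))\<^sup>2"
proof -
  have form: "y_op C \<beta> G u \<bullet> v = G u \<bullet> v + \<beta> * (C u \<bullet> C v)" for u v
    by (simp add: y_op_def inner_add_left) (metis adj inner_commute)
  then show "y_op C \<beta> G u \<bullet> u = G u \<bullet> u + \<beta> * (norm (C u))\<^sup>2"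
    by (simp add: power2_norm_eq_inner)
  have "linear G" using G by (simp add: self_adjoint_psd_def)
  then have "linear (y_op C \<beta> G)"
    unfolding y_op_def
    by (intro linearI)
      (simp_all add: linear_add linear_scale C linear_adjointI[OF adj] algebra_simps)
  moreover have "y_op C \<beta> G u \<bullet> v = u \<bullet> y_op C \<beta> G v" for u v
  proof -
    have "G u \<bullet> v = G v \<bullet> u" using G by (simp add: self_adjoint_psd_def inner_commute)
    then have "y_op C \<beta> G u \<bullet> v = y_op C \<beta> G v \<bullet> u"
      by (simp add: form inner_commute[of "C u" "C v"])
    then show ?thesis by (simp add: inner_commute)
  qed
  moreover have "0 \<le> y_op C \<beta> G v \<bullet> v" for v
    using psd_form_nonneg[OF G, of v] \<open>\<beta> > 0\<close> unfolding form by simp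
  ultimately show "self_adjoint_psd (y_op C \<beta> G)"
    unfolding self_adjoint_psd_def by blast
qed

section \<open>Optimality conditions of the proximal subproblems\<close>

text \<open>Serves both the s-step and the y-step, with \<open>b\<close> collecting the block held
  fixed. The smooth part is exactly quadratic along lines, and the vector in the conclusion is minus
  its gradient at \<open>m\<close>.\<close>

lemma prox_subproblem_optimality:
  fixes f :: "'a::real_inner \<Rightarrow> ereal" and A :: "'a \<Rightarrow> 'x::real_inner"
  assumes f: "proper_closed_convex f" and A: "linear A"
    and adj: "\<And>u w. A u \<bullet> w = u \<bullet> adjoint A w"
    and M: "self_adjoint_psd M"
    and \<phi>: "\<And>z. \<phi> z = A z + b"
    and min: "is_arg_min (\<lambda>z. f z + ereal (- (adjoint A w \<bullet> z) + \<beta> / 2 * (norm (\<phi> z))\<^sup>2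
        + 1 / 2 * (seminorm_op M (z - p))\<^sup>2)) (\<lambda>z. True) m"
  shows "adjoint A (w - \<beta> *\<^sub>R \<phi> m) + M (p - m) \<in> subdifferential f m"
proof (rule arg_min_subgradient[OF f min])
  fix d t
  let ?r = "\<lambda>d. \<beta> / 2 * (norm (A d))\<^sup>2 + 1 / 2 * (M d \<bullet> d)"
  have lin: "linear M" using M by (simp add: self_adjoint_psd_def)
  have "\<phi> (m + t *\<^sub>R d) = \<phi> m + t *\<^sub>R A d"
    by (simp add: \<phi> linear_add[OF A] linear_scale[OF A])
  then have 1: "(norm (\<phi> (m + t *\<^sub>R d)))\<^sup>2
      = (norm (\<phi> m))\<^sup>2 + 2 * t * (\<phi> m \<bullet> A d) + t\<^sup>2 * (norm (A d))\<^sup>2"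
    by (simp only: power2_norm_eq_inner)
       (simp add: inner_add_left inner_add_right inner_commute[of "A d" "\<phi> m"] algebra_simps power2_eq_square)
  have "m + t *\<^sub>R d - p = (m - p) + t *\<^sub>R d" by simp
  then have 2: "(seminorm_op M (m + t *\<^sub>R d - p))\<^sup>2
      = (seminorm_op M (m - p))\<^sup>2 + 2 * t * (M (m - p) \<bullet> d) + t\<^sup>2 * (M d \<bullet> d)"
    by (simp only: seminorm_op_sq[OF M] psd_add_form[OF M])
       (simp add: linear_scale[OF lin] power2_eq_square)
  have 3: "(adjoint A (w - \<beta> *\<^sub>R \<phi> m) + M (p - m)) \<bullet> d
      = adjoint A w \<bullet> d - \<beta> * (\<phi> m \<bullet> A d) - M (m - p) \<bullet> d"
  proof -
    have "adjoint A (w - \<beta> *\<^sub>R \<phi> m) \<bullet> d = A d \<bullet> (w - \<beta> *\<^sub>R \<phi> m)"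
      by (simp only: adj inner_commute)
    also have "\<dots> = A d \<bullet> w - \<beta> * (\<phi> m \<bullet> A d)"
      by (simp add: inner_diff_right inner_commute[of "A d" "\<phi> m"])
    also have "A d \<bullet> w = adjoint A w \<bullet> d" using adj[of d w] by (simp only: inner_commute)
    finally show ?thesis
      using psd_minus_form[OF M, of "m - p"] by (simp add: inner_diff_left)
  qed
  show "- (adjoint A w \<bullet> (m + t *\<^sub>R d)) + \<beta> / 2 * (norm (\<phi> (m + t *\<^sub>R d)))\<^sup>2
        + 1 / 2 * (seminorm_op M (m + t *\<^sub>R d - p))\<^sup>2
      = - (adjoint A w \<bullet> m) + \<beta> / 2 * (norm (\<phi> m))\<^sup>2 + 1 / 2 * (seminorm_op M (m - p))\<^sup>2
        - t * ((adjoint A (w - \<beta> *\<^sub>R \<phi> m) + M (p - m)) \<bullet> d)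
        + t\<^sup>2 * ?r d"
    unfolding 1 2 3 by (simp add: inner_add_right algebra_simps)
qed

section \<open>The proximal ADMM iterates\<close>

text \<open>The adjoint identities stand in for finite dimension. The golden ratio enters only as a
  hypothesis of \<open>step_sum_le\<close>.\<close>

locale admm_iteration =
  fixes f :: "'y::real_inner \<Rightarrow> ereal" and g :: "'s::real_inner \<Rightarrow> ereal"
    and C :: "'y \<Rightarrow> 'x::real_inner" and D :: "'s \<Rightarrow> 'x" and c :: 'x
    and \<beta> \<theta> :: real and H :: "'s \<Rightarrow> 's" and G :: "'y \<Rightarrow> 'y"
    and s :: "nat \<Rightarrow> 's" and y :: "nat \<Rightarrow> 'y" and x :: "nat \<Rightarrow> 'x"
  assumes f: "proper_closed_convex f" and g: "proper_closed_convex g"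
    and C: "linear C" and D: "linear D"
    and C_adj: "\<And>u w. C u \<bullet> w = u \<bullet> adjoint C w"
    and D_adj: "\<And>u w. D u \<bullet> w = u \<bullet> adjoint D w"
    and beta: "\<beta> > 0" and theta_pos: "\<theta> > 0"
    and H: "self_adjoint_psd H" and G: "self_adjoint_psd G"
    and admm: "prox_admm f g C D c \<beta> \<theta> H G s y x"
begin

abbreviation Y :: "'y \<Rightarrow> 'y" where "Y \<equiv> y_op C \<beta> G"

definition xt :: "nat \<Rightarrow> 'x" where
  "xt k = x (k - 1) - \<beta> *\<^sub>R (C (y (k - 1)) + D (s k) - c)"

definition res :: "nat \<Rightarrow> 'x" where
  "res k = C (y k) + D (s k) - c"

definition step_sq :: "nat \<Rightarrow> real" where
  "step_sq k = (seminorm_op H (s (k - 1) - s k))\<^sup>2 + (seminorm_op Y (y (k - 1) - y k))\<^sup>2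
    + 1 / (\<beta> * \<theta>) * (norm (x (k - 1) - x k))\<^sup>2"

lemmas Y_psd = self_adjoint_psd_y_op(1)[OF C C_adj beta G]
lemmas Y_form = self_adjoint_psd_y_op(2)[OF C C_adj beta G]

lemma res_eq:
  assumes "1 \<le> k"
  shows "res k = (1 / (\<beta> * \<theta>)) *\<^sub>R (x (k - 1) - x k)"
proof -
  have "x k = x (k - 1) - (\<theta> * \<beta>) *\<^sub>R res k"
    using admm assms by (auto simp: prox_admm_def res_def)
  then have "x (k - 1) - x k = (\<beta> * \<theta>) *\<^sub>R res k" by (simp add: mult.commute)
  then show ?thesis using beta theta_pos by simp
qed

lemma s_optimality:
  assumes "1 \<le> k"
  shows "adjoint D (xt k) + H (s (k - 1) - s k) \<in> subdifferential g (s k)"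
  unfolding xt_def
  by (rule prox_subproblem_optimality[OF g D D_adj H, where \<phi> = "\<lambda>z. C (y (k - 1)) + D z - c"
        and b = "C (y (k - 1)) - c"])
    (use admm assms in \<open>auto simp: prox_admm_def\<close>)

text \<open>The form with \<open>G\<close> and the natural multiplier of the y-step; comparing
  consecutive iterates with it yields the telescoping \<open>R\<close> terms.\<close>

lemma y_optimality:
  assumes "1 \<le> k"
  shows "adjoint C (x (k - 1) - \<beta> *\<^sub>R res k) + G (y (k - 1) - y k) \<in> subdifferential f (y k)"
  unfolding res_def
  by (rule prox_subproblem_optimality[OF f C C_adj G, where \<phi> = "\<lambda>z. C z + D (s k) - c"
        and b = "D (s k) - c"])
    (use admm assms in \<open>auto simp: prox_admm_def\<close>)

lemma xt_eq: "xt k = x (k - 1) - \<beta> *\<^sub>R res k + \<beta> *\<^sub>R C (y k - y (k - 1))"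
  by (simp add: xt_def res_def linear_diff[OF C] algebra_simps)

text \<open>Passing to the multiplier \<open>xt k\<close> of the s-step adds \<beta> times
  \<open>adjoint C\<close> of \<open>C (y k - y (k - 1))\<close>, which the change from
  \<open>G\<close> to \<open>Y\<close> absorbs.\<close>

lemma y_optimality_xt:
  assumes "1 \<le> k"
  shows "adjoint C (xt k) + Y (y (k - 1) - y k) \<in> subdifferential f (y k)"
proof -
  have lin: "linear (adjoint C)" by (rule linear_adjointI[OF C_adj])
  have "adjoint C (xt k) + Y (y (k - 1) - y k)
    = adjoint C (x (k - 1) - \<beta> *\<^sub>R res k) + G (y (k - 1) - y k)"
    by (simp add: xt_eq y_op_def linear_diff[OF C] linear_diff[OF lin] linear_add[OF lin]
        linear_scale[OF lin] algebra_simps)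
  then show ?thesis using y_optimality[OF assms] by simp
qed

section \<open>Summed squared steps against a KKT point\<close>

text \<open>Stated for an arbitrary KKT point, so that the infimum can be taken afterwards.\<close>

lemma step_sum_le:
  assumes theta: "\<theta> \<in> {0<..<(sqrt 5 + 1) / 2}"
    and kkt: "(s', y', x') \<in> kkt_points f g C D c" and "1 \<le> k"
  shows "(1 - sigma_const \<theta>) * (\<Sum>i=1..k. step_sq i)
    \<le> 4 * (1 + sigma_const \<theta> + 2 * tau_const \<theta>)
      * (1 / 2 * (seminorm_op H (s 0 - s'))\<^sup>2 + 1 / 2 * (seminorm_op Y (y 0 - y'))\<^sup>2
        + 1 / (2 * \<beta> * \<theta>) * (norm (x 0 - x'))\<^sup>2)"
proof -
  have g': "adjoint D x' \<in> subdifferential g s'" and f': "adjoint C x' \<in> subdifferential f y'"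
    and feas: "C y' + D s' = c"
    using kkt by (auto simp: kkt_points_def kkt_map_def zero_prod_def)
  define \<delta>s where "\<delta>s k = s k - s (k - 1)" for k
  define \<delta>y where "\<delta>y k = y k - y (k - 1)" for k
  define \<delta>x where "\<delta>x k = x k - x (k - 1)" for k
  define \<gamma> where "\<gamma> = 1 / (\<beta> * \<theta>)"
  \<comment> \<open>Twice the expression minimised in \<open>dist_sq_kkt\<close>, hence the factor 4
    here against 2 in \<open>admm_summation\<close>.\<close>
  define E where "E k = H (s k - s') \<bullet> (s k - s') + Y (y k - y') \<bullet> (y k - y')
    + \<gamma> * (norm (x k - x'))\<^sup>2" for k
  define P where "P k = H (\<delta>s k) \<bullet> \<delta>s k" for k
  define R where "R k = G (\<delta>y k) \<bullet> \<delta>y k" for k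
  define U where "U k = \<gamma> * (norm (\<delta>x k))\<^sup>2" for k
  define V where "V k = \<beta> * (norm (C (\<delta>y k)))\<^sup>2" for k
  define W where "W k = C (\<delta>y k) \<bullet> \<delta>x k / \<theta>" for k
  define W' where "W' k = C (\<delta>y k) \<bullet> \<delta>x (k - 1)" for k
  have \<gamma>: "0 < \<gamma>" "\<gamma> * \<beta> = 1 / \<theta>" using beta theta_pos by (auto simp: \<gamma>_def)
  have YRV: "Y (\<delta>y k) \<bullet> \<delta>y k = R k + V k" for k by (simp add: Y_form R_def V_def)
  have res: "res k = - \<gamma> *\<^sub>R \<delta>x k" if "1 \<le> k" for k
    using res_eq[OF that] by (simp add: \<gamma>_def \<delta>x_def algebra_simps)
  have \<beta>res: "\<beta> *\<^sub>R res k = - (1 / \<theta>) *\<^sub>R \<delta>x k" if "1 \<le> k" for k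
    using res[OF that] \<gamma>(2) by (simp add: mult.commute)
  have descent: "E k + P k + R k + V k + (2 / \<theta> - 1) * U k + 2 * W k \<le> E (k - 1)"
    if k: "1 \<le> k" for k
  proof -
    \<comment> \<open>Monotonicity of both subdifferentials against the KKT point. By feasibility of
      that point the multiplier terms add up to \<open>res k \<bullet> (xt k - x')\<close>.\<close>
    have "0 \<le> (adjoint D (xt k) + H (s (k - 1) - s k) - adjoint D x') \<bullet> (s k - s')"
      by (rule subdifferential_monotone[OF g s_optimality[OF k] g'])
    also have "\<dots> = D (s k - s') \<bullet> (xt k - x') - H (\<delta>s k) \<bullet> (s k - s')"
      using psd_minus_form[OF H, of "\<delta>s k"] D_adj[of "s k - s'"]
      by (simp add: \<delta>s_def inner_diff_left inner_add_left inner_diff_right inner_commute[of "adjoint D _"])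
    finally have 1: "0 \<le> D (s k - s') \<bullet> (xt k - x') - H (\<delta>s k) \<bullet> (s k - s')" .
    have "0 \<le> (adjoint C (xt k) + Y (y (k - 1) - y k) - adjoint C x') \<bullet> (y k - y')"
      by (rule subdifferential_monotone[OF f y_optimality_xt[OF k] f'])
    also have "\<dots> = C (y k - y') \<bullet> (xt k - x') - Y (\<delta>y k) \<bullet> (y k - y')"
      using psd_minus_form[OF Y_psd, of "\<delta>y k"] C_adj[of "y k - y'"]
      by (simp add: \<delta>y_def inner_diff_left inner_add_left inner_diff_right inner_commute[of "adjoint C _"])
    finally have 2: "0 \<le> C (y k - y') \<bullet> (xt k - x') - Y (\<delta>y k) \<bullet> (y k - y')" .
    have "D (s k - s') + C (y k - y') = res k"
      unfolding res_def unfolding feas[symmetric] by (simp add: linear_diff[OF C] linear_diff[OF D])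
    then have 3: "D (s k - s') \<bullet> (xt k - x') + C (y k - y') \<bullet> (xt k - x') = res k \<bullet> (xt k - x')"
      by (metis inner_add_left)
    \<comment> \<open>The three summands yield the change of the multiplier distance, a multiple of
      \<open>U k\<close>, and the cross term \<open>W k\<close>.\<close>
    have "xt k - x' = (x k - x') + (1 / \<theta> - 1) *\<^sub>R \<delta>x k + \<beta> *\<^sub>R C (\<delta>y k)"
      using \<beta>res[OF k] by (simp add: xt_eq \<delta>y_def \<delta>x_def algebra_simps)
    then have "res k \<bullet> (xt k - x') = - (\<gamma> * (\<delta>x k \<bullet> (x k - x'))
        + (1 / \<theta> - 1) * (\<gamma> * (\<delta>x k \<bullet> \<delta>x k)) + \<gamma> * \<beta> * (\<delta>x k \<bullet> C (\<delta>y k)))"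
      using res[OF k] by (simp only:) (simp add: inner_add_right algebra_simps)
    also have "\<dots> = - (\<gamma> * (\<delta>x k \<bullet> (x k - x')) + (1 / \<theta> - 1) * U k + W k)"
      by (simp add: \<gamma>(2) U_def W_def power2_norm_eq_inner inner_commute)
    finally have 4: "res k \<bullet> (xt k - x')
      = - (\<gamma> * (\<delta>x k \<bullet> (x k - x')) + (1 / \<theta> - 1) * U k + W k)" .
    have "2 * (\<delta>x k \<bullet> (x k - x'))
      = (norm (x k - x'))\<^sup>2 - (norm (x (k - 1) - x'))\<^sup>2 + (norm (\<delta>x k))\<^sup>2"
      using psd_three_point[OF self_adjoint_psd_id, of "x k" "x (k - 1)" x']
      by (simp add: \<delta>x_def power2_norm_eq_inner)
    then have "\<gamma> * (2 * (\<delta>x k \<bullet> (x k - x')))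
      = \<gamma> * ((norm (x k - x'))\<^sup>2 - (norm (x (k - 1) - x'))\<^sup>2 + (norm (\<delta>x k))\<^sup>2)"
      by (rule arg_cong)
    then have 5: "2 * (\<gamma> * (\<delta>x k \<bullet> (x k - x')))
      = \<gamma> * (norm (x k - x'))\<^sup>2 - \<gamma> * (norm (x (k - 1) - x'))\<^sup>2 + U k"
      by (simp only: U_def distrib_left right_diff_distrib mult.left_commute)
    have "0 \<le> - 2 * (\<gamma> * (\<delta>x k \<bullet> (x k - x'))) - 2 * ((1 / \<theta> - 1) * U k) - 2 * W k
      - 2 * (H (\<delta>s k) \<bullet> (s k - s')) - 2 * (Y (\<delta>y k) \<bullet> (y k - y'))"
      using 1 2 3 4 by linarith
    moreover have "2 * (H (\<delta>s k) \<bullet> (s k - s'))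
      = H (s k - s') \<bullet> (s k - s') - H (s (k - 1) - s') \<bullet> (s (k - 1) - s') + P k"
      unfolding \<delta>s_def P_def by (rule psd_three_point[OF H])
    moreover have "2 * (Y (\<delta>y k) \<bullet> (y k - y'))
      = Y (y k - y') \<bullet> (y k - y') - Y (y (k - 1) - y') \<bullet> (y (k - 1) - y') + (R k + V k)"
      unfolding YRV[symmetric] \<delta>y_def by (rule psd_three_point[OF Y_psd])
    moreover have "(2 / \<theta> - 1) * U k = 2 * ((1 / \<theta> - 1) * U k) + U k"
      by (simp add: algebra_simps)
    ultimately show ?thesis using 5 unfolding E_def by linarith
  qed
  have cross: "2 * ((1 / \<theta> - 1) * W' k) + (R k - R (k - 1)) \<le> 2 * W k" if k: "2 \<le> k" for k
  proof -
    \<comment> \<open>The multiplier in \<open>y_optimality\<close>. Monotonicity is applied at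
      iterates k and k - 1, and optimality at k - 1 requires k to be at least 2.\<close>
    define p where "p k = x (k - 1) - \<beta> *\<^sub>R res k" for k
    have k': "1 \<le> k" "1 \<le> k - 1" using k by auto
    have "0 \<le> (adjoint C (p k) + G (y (k - 1) - y k)
        - (adjoint C (p (k - 1)) + G (y (k - 1 - 1) - y (k - 1)))) \<bullet> (y k - y (k - 1))"
      unfolding p_def
      by (rule subdifferential_monotone[OF f y_optimality[OF k'(1)] y_optimality[OF k'(2)]])
    also have "\<dots> = C (\<delta>y k) \<bullet> (p k - p (k - 1)) - R k + G (\<delta>y (k - 1)) \<bullet> \<delta>y k"
    proof -
      have "G (y (k - 1) - y k) = - G (\<delta>y k)"
        "G (y (k - 1 - 1) - y (k - 1)) = - G (\<delta>y (k - 1))"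
        using psd_minus_form[OF G, of "\<delta>y k"] psd_minus_form[OF G, of "\<delta>y (k - 1)"]
        by (simp_all add: \<delta>y_def)
      moreover have "C (\<delta>y k) \<bullet> (p k - p (k - 1))
        = adjoint C (p k) \<bullet> \<delta>y k - adjoint C (p (k - 1)) \<bullet> \<delta>y k"
        by (simp only: inner_diff_right C_adj inner_commute[of "adjoint C _" "\<delta>y k"])
      ultimately show ?thesis
        unfolding \<delta>y_def[of k, symmetric] R_def by (simp add: inner_diff_left inner_add_left)
    qed
    also have "p k - p (k - 1) = (1 / \<theta>) *\<^sub>R \<delta>x k - (1 / \<theta> - 1) *\<^sub>R \<delta>x (k - 1)"
      using \<beta>res[OF k'(1)] \<beta>res[OF k'(2)] by (simp add: p_def \<delta>x_def algebra_simps)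
    also have "C (\<delta>y k) \<bullet> \<dots> = W k - (1 / \<theta> - 1) * W' k"
      by (simp add: W_def W'_def inner_diff_right)
    finally have "0 \<le> W k - (1 / \<theta> - 1) * W' k - R k + G (\<delta>y (k - 1)) \<bullet> \<delta>y k" .
    \<comment> \<open>Young's inequality turns the mixed \<open>G\<close> term into the telescoping
      difference of \<open>R\<close>.\<close>
    moreover have "2 * (G (\<delta>y (k - 1)) \<bullet> \<delta>y k) \<le> R (k - 1) + R k"
      unfolding R_def by (rule psd_young[OF G])
    ultimately show ?thesis by linarith
  qed
  have nonneg: "0 \<le> E k" "0 \<le> P k" "0 \<le> R k" "0 \<le> U k" "0 \<le> V k" for k
    using psd_form_nonneg[OF H] psd_form_nonneg[OF G] psd_form_nonneg[OF Y_psd] \<gamma> beta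
    by (auto simp: E_def P_def R_def U_def V_def intro!: add_nonneg_nonneg)
  have cs: "(u \<bullet> v)\<^sup>2 \<le> (norm v)\<^sup>2 * (norm u)\<^sup>2" for u v :: 'x
    using Cauchy_Schwarz_ineq[of u v] by (simp add: power2_norm_eq_inner mult.commute)
  have W: "(W k)\<^sup>2 \<le> U k * V k / \<theta>" for k
  proof -
    have "(W k)\<^sup>2 \<le> (norm (\<delta>x k))\<^sup>2 * (norm (C (\<delta>y k)))\<^sup>2 / \<theta>\<^sup>2"
      unfolding W_def power_divide by (intro divide_right_mono cs) simp
    also have "\<dots> = U k * V k / \<theta>"
      using beta theta_pos by (simp add: U_def V_def \<gamma>_def power2_eq_square)
    finally show ?thesis .
  qed
  have W': "(W' k)\<^sup>2 \<le> \<theta> * (U (k - 1) * V k)" for k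
    using cs[of "C (\<delta>y k)" "\<delta>x (k - 1)"] beta theta_pos by (simp add: W'_def U_def V_def \<gamma>_def)
  \<comment> \<open>The first step is measured by a detour through the KKT point, in each of the
    three components.\<close>
  have U1: "U 1 \<le> 2 * (\<gamma> * (norm (x 1 - x'))\<^sup>2) + 2 * (\<gamma> * (norm (x 0 - x'))\<^sup>2)"
  proof -
    have "(norm (\<delta>x 1))\<^sup>2 \<le> 2 * (norm (x 1 - x'))\<^sup>2 + 2 * (norm (x 0 - x'))\<^sup>2"
      using psd_diff_le[OF self_adjoint_psd_id, of "x 1" "x 0" x']
      by (simp add: \<delta>x_def power2_norm_eq_inner)
    then have "\<gamma> * (norm (\<delta>x 1))\<^sup>2 \<le> \<gamma> * (2 * (norm (x 1 - x'))\<^sup>2 + 2 * (norm (x 0 - x'))\<^sup>2)"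
      using \<gamma>(1) by (intro mult_left_mono) auto
    then show ?thesis by (simp only: U_def distrib_left mult.left_commute)
  qed
  moreover have "P 1 \<le> 2 * (H (s 1 - s') \<bullet> (s 1 - s')) + 2 * (H (s 0 - s') \<bullet> (s 0 - s'))"
    using psd_diff_le[OF H, of "s 1" "s 0" s'] by (simp add: P_def \<delta>s_def)
  moreover have "R 1 + V 1 \<le> 2 * (Y (y 1 - y') \<bullet> (y 1 - y')) + 2 * (Y (y 0 - y') \<bullet> (y 0 - y'))"
    using psd_diff_le[OF Y_psd, of "y 1" "y 0" y'] by (simp add: YRV[symmetric] \<delta>y_def)
  ultimately have N1: "P 1 + R 1 + V 1 + U 1 \<le> 2 * E 1 + 2 * E 0"
    unfolding E_def distrib_left by linarith
  then have U1': "U 1 \<le> 2 * E 1 + 2 * E 0" using nonneg[of 1] by linarith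
  have "step_sq i = P i + R i + V i + U i" for i
    using psd_minus_form[OF H, of "\<delta>s i"] psd_minus_form[OF Y_psd, of "\<delta>y i"] YRV[of i]
    by (simp add: step_sq_def seminorm_op_sq[OF H] seminorm_op_sq[OF Y_psd] P_def U_def \<gamma>_def
        \<delta>s_def \<delta>y_def \<delta>x_def norm_minus_commute)
       (simp add: inner_diff_right)
  then have "(1 - sigma_const \<theta>) * (\<Sum>i=1..k. step_sq i)
    \<le> 2 * (1 + sigma_const \<theta> + 2 * tau_const \<theta>) * E 0"
    using admm_summation[OF theta nonneg descent cross W W' U1' N1 \<open>1 \<le> k\<close>] by simp
  also have "E 0 = 2 * (1 / 2 * (seminorm_op H (s 0 - s'))\<^sup>2 + 1 / 2 * (seminorm_op Y (y 0 - y'))\<^sup>2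
        + 1 / (2 * \<beta> * \<theta>) * (norm (x 0 - x'))\<^sup>2)"
    by (simp add: E_def seminorm_op_sq[OF H] seminorm_op_sq[OF Y_psd] \<gamma>_def)
  finally show ?thesis by (simp only: mult.assoc mult.left_commute)
qed

end

section \<open>Best iterate and infimum over KKT points\<close>

theorem theorem2p1:
  fixes f :: "'y::real_inner \<Rightarrow> ereal" and g :: "'s::real_inner \<Rightarrow> ereal"
    and C :: "'y \<Rightarrow> 'x::real_inner" and D :: "'s \<Rightarrow> 'x" and c :: 'x
    and \<beta> \<theta> :: real and H :: "'s \<Rightarrow> 's" and G :: "'y \<Rightarrow> 'y"
    and s :: "nat \<Rightarrow> 's" and y :: "nat \<Rightarrow> 'y" and x :: "nat \<Rightarrow> 'x"
  assumes fin_dim_S: "\<exists>B::'s set. finite B \<and> span B = UNIV"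
    and fin_dim_Y: "\<exists>B::'y set. finite B \<and> span B = UNIV"
    and fin_dim_X: "\<exists>B::'x set. finite B \<and> span B = UNIV"
    and f: "proper_closed_convex f" and g: "proper_closed_convex g"
    and C: "linear C" and D: "linear D"
    and A1: "kkt_points f g C D c \<noteq> {}"
    and A2: "\<exists>w. (adjoint C w, adjoint D w)
               \<in> rel_interior (eff_dom (conjugate f)) \<times> rel_interior (eff_dom (conjugate g))"
    and beta: "\<beta> > 0" and theta: "\<theta> \<in> {0<..<(sqrt 5 + 1) / 2}"
    and H: "self_adjoint_psd H" and G: "self_adjoint_psd G"
    and admm: "prox_admm f g C D c \<beta> \<theta> H G s y x"
  shows "\<forall>k\<ge>1.
    (let xt = x (k-1) - \<beta> *\<^sub>R (C (y (k-1)) + D (s k) - c) in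
       H (s (k-1) - s k) \<in> (\<lambda>u. u - adjoint D xt) ` subdifferential g (s k) \<and>
       y_op C \<beta> G (y (k-1) - y k) \<in> (\<lambda>u. u - adjoint C xt) ` subdifferential f (y k) \<and>
       (1 / (\<beta> * \<theta>)) *\<^sub>R (x (k-1) - x k) = C (y k) + D (s k) - c) \<and>
    (\<exists>i. 1 \<le> i \<and> i \<le> k \<and>
       sqrt ((seminorm_op H (s (i-1) - s i))\<^sup>2
             + (seminorm_op (y_op C \<beta> G) (y (i-1) - y i))\<^sup>2
             + 1 / (\<beta> * \<theta>) * (norm (x (i-1) - x i))\<^sup>2)
       \<le> 2 * sqrt (dist_sq_kkt f g C D c \<beta> \<theta> H G (s 0) (y 0) (x 0)) / sqrt (real k)
           * sqrt ((1 + sigma_const \<theta> + 2 * tau_const \<theta>) / (1 - sigma_const \<theta>)))"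
proof (intro allI impI conjI)
  have "\<theta> > 0" using theta by simp
  then interpret admm_iteration f g C D c \<beta> \<theta> H G s y x
    by (intro admm_iteration.intro adjoint_works_finite_dim[OF fin_dim_Y C]
        adjoint_works_finite_dim[OF fin_dim_S D] assms)
  fix k :: nat
  assume k: "1 \<le> k"
  show "let xt = x (k-1) - \<beta> *\<^sub>R (C (y (k-1)) + D (s k) - c) in
       H (s (k-1) - s k) \<in> (\<lambda>u. u - adjoint D xt) ` subdifferential g (s k) \<and>
       y_op C \<beta> G (y (k-1) - y k) \<in> (\<lambda>u. u - adjoint C xt) ` subdifferential f (y k) \<and>
       (1 / (\<beta> * \<theta>)) *\<^sub>R (x (k-1) - x k) = C (y k) + D (s k) - c"
    unfolding Let_def xt_def[symmetric] res_eq[OF k, symmetric]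
    by (intro conjI image_eqI[OF _ s_optimality[OF k]] image_eqI[OF _ y_optimality_xt[OF k]])
       (simp_all add: res_def)
  define \<sigma> where "\<sigma> = sigma_const \<theta>"
  define \<tau> where "\<tau> = tau_const \<theta>"
  note sig = sigma_const_bounds[OF theta, folded \<sigma>_def]
  have "0 \<le> \<tau>" using theta by (simp add: \<tau>_def tau_const_def le_max_iff_disj)
  then have pos: "0 < 4 * (1 + \<sigma> + 2 * \<tau>)" using sig by simp
  define d where "d = dist_sq_kkt f g C D c \<beta> \<theta> H G (s 0) (y 0) (x 0)"
  \<comment> \<open>The shortest step is at most the average. Its index is fixed before any KKT
    point is, so one \<open>i\<close> serves all of them.\<close>
  have "Min (step_sq ` {1..k}) \<in> step_sq ` {1..k}" using k by (intro Min_in) auto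
  then obtain i where "i \<in> {1..k}" "step_sq i = Min (step_sq ` {1..k})" by auto
  then have i: "i \<in> {1..k}" "\<And>j. j \<in> {1..k} \<Longrightarrow> step_sq i \<le> step_sq j" by auto
  have "real k * step_sq i \<le> (\<Sum>j=1..k. step_sq j)"
    using sum_bounded_below[of "{1..k}" "step_sq i" step_sq] i(2) by simp
  then have "(1 - \<sigma>) * (real k * step_sq i) \<le> (1 - \<sigma>) * (\<Sum>j=1..k. step_sq j)"
    using sig by (intro mult_left_mono) auto
  \<comment> \<open>Solved for the distance term: the left side is free of the KKT point and is thus
    a lower bound for the infimum, which ranges over a nonempty set by \<open>A1\<close>.\<close>
  then have le: "(1 - \<sigma>) * (real k * step_sq i) / (4 * (1 + \<sigma> + 2 * \<tau>))
      \<le> 1 / 2 * (seminorm_op H (s 0 - s'))\<^sup>2 + 1 / 2 * (seminorm_op Y (y 0 - y'))\<^sup>2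
        + 1 / (2 * \<beta> * \<theta>) * (norm (x 0 - x'))\<^sup>2"
    if "(s', y', x') \<in> kkt_points f g C D c" for s' y' x'
    using step_sum_le[OF theta that k, folded \<sigma>_def \<tau>_def] pos
    by (subst pos_divide_le_eq) (auto simp: mult.commute)
  have "(1 - \<sigma>) * (real k * step_sq i) / (4 * (1 + \<sigma> + 2 * \<tau>)) \<le> d"
    unfolding d_def dist_sq_kkt_def using A1 le by (intro cINF_greatest) auto
  then have "step_sq i \<le> 4 * d / real k * ((1 + \<sigma> + 2 * \<tau>) / (1 - \<sigma>))"
    using pos sig k by (simp add: field_simps)
  then have "sqrt (step_sq i) \<le> sqrt (4 * d / real k * ((1 + \<sigma> + 2 * \<tau>) / (1 - \<sigma>)))"
    by (rule real_sqrt_le_mono)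
  also have "\<dots> = 2 * sqrt d / sqrt (real k) * sqrt ((1 + \<sigma> + 2 * \<tau>) / (1 - \<sigma>))"
    by (simp add: real_sqrt_mult real_sqrt_divide)
  finally show "\<exists>i. 1 \<le> i \<and> i \<le> k \<and>
       sqrt ((seminorm_op H (s (i-1) - s i))\<^sup>2
             + (seminorm_op (y_op C \<beta> G) (y (i-1) - y i))\<^sup>2
             + 1 / (\<beta> * \<theta>) * (norm (x (i-1) - x i))\<^sup>2)
       \<le> 2 * sqrt (dist_sq_kkt f g C D c \<beta> \<theta> H G (s 0) (y 0) (x 0)) / sqrt (real k)
           * sqrt ((1 + sigma_const \<theta> + 2 * tau_const \<theta>) / (1 - sigma_const \<theta>))"
    using i(1) by (intro exI[of _ i]) (simp add: step_sq_def \<sigma>_def \<tau>_def d_def)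
qed

end
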